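(* Let $(H_n)_{n\ge 1}$ be a sequence where $H_n$ is an $n\times n$ positive semidefinite (Hermitian) matrix, and suppose there is a constant $K$, independent of $n$, such that the spectral norm satisfies $\|H_n\|\le K$ for all $n$. Then for every fixed $\tau\in\mathbb{R}$, $$S(\varrho_{H_n}^\tau)=\log n - O(1)\qquad (n\to\infty).$$
   Context: For a Hermitian matrix $H$ and real $\tau$, the Gibbs state is $\varrho_H^\tau=\exp(-\tau H)/Z$ with $Z=\mathrm{Tr}(\exp(-\tau H))$. The von Neumann entropy of a density matrix $\varrho$ is $S(\varrho)=-\mathrm{Tr}(\varrho\log\varrho)$, where $\log$ is the natural logarithm (i.e. the Shannon entropy of the eigenvalues of $\varrho$). $O(1)$ denotes a sequence bounded in absolute value by a constant (independent of $n$) for all sufficiently large $n$. *)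

theory Defs
  imports
    "HOL-Analysis.Analysis"
    "HOL-Library.Landau_Symbols"
    "Jordan_Normal_Form.Schur_Decomposition"
begin

(* Matrices are those of Jordan_Normal_Form.Matrix, whose dimension is a value and not a type,
   so that a sequence of matrices of growing size can be stated. *)

definition hermitian_mat :: "complex mat \<Rightarrow> bool" where
  "hermitian_mat A \<longleftrightarrow> square_mat A \<and> mat_adjoint A = A"

definition psd_mat :: "complex mat \<Rightarrow> bool" where
  "psd_mat A \<longleftrightarrow> hermitian_mat A \<and>
     (\<forall>v \<in> carrier_vec (dim_row A). 0 \<le> Re ((A *\<^sub>v v) \<bullet>c v))"

definition mat_trace :: "complex mat \<Rightarrow> complex" where
  "mat_trace A = (\<Sum>i<dim_row A. A $$ (i, i))"

definition vec_norm2 :: "complex vec \<Rightarrow> real" where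
  "vec_norm2 v = sqrt (\<Sum>i<dim_vec v. (cmod (v $ i))\<^sup>2)"

(* Operator norm with respect to the Euclidean norm. *)
definition spectral_norm :: "complex mat \<Rightarrow> real" where
  "spectral_norm A =
     (SUP v \<in> {v \<in> carrier_vec (dim_col A). vec_norm2 v \<le> 1}. vec_norm2 (A *\<^sub>v v))"

(* The exponential power series, summed entry by entry. *)
definition mat_exp :: "complex mat \<Rightarrow> complex mat" where
  "mat_exp A = mat (dim_row A) (dim_row A) (\<lambda>(i, j). \<Sum>k. (A ^\<^sub>m k) $$ (i, j) / fact k)"

definition unitary_diagonalization :: "complex mat \<Rightarrow> complex mat \<Rightarrow> (nat \<Rightarrow> real) \<Rightarrow> bool" where
  "unitary_diagonalization A U d \<longleftrightarrow>
     U \<in> carrier_mat (dim_row A) (dim_row A) \<and>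
     mat_adjoint U * U = 1\<^sub>m (dim_row A) \<and>
     A = U * mat_diag (dim_row A) (\<lambda>i. complex_of_real (d i)) * mat_adjoint U"

(* Functional calculus f(A) = U diag(f(d)) U* for a Hermitian matrix A = U diag(d) U*.
   Meaningful only for Hermitian A; the lemma below shows independence of the choice of U and d. *)
definition hermitian_fun :: "(real \<Rightarrow> real) \<Rightarrow> complex mat \<Rightarrow> complex mat" where
  "hermitian_fun f A =
     (THE B. \<exists>U d. unitary_diagonalization A U d \<and>
        B = U * mat_diag (dim_row A) (\<lambda>i. complex_of_real (f (d i))) * mat_adjoint U)"

lemma mat_adjoint_carrier:
  "A \<in> carrier_mat n m \<Longrightarrow> mat_adjoint A \<in> carrier_mat m n"
  unfolding mat_adjoint_def by auto

lemma hermitian_fun_eq: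
  assumes "unitary_diagonalization A U d"
  shows "hermitian_fun f A =
    U * mat_diag (dim_row A) (\<lambda>i. complex_of_real (f (d i))) * mat_adjoint U"
proof -
  define n where "n = dim_row A"
  define D where "D = (\<lambda>d :: nat \<Rightarrow> real. mat_diag n (\<lambda>i. complex_of_real (d i)))"
  note mat_simps = assoc_mult_mat [of _ n n _ n _ n] mult_carrier_mat [of _ n n _ n]
    right_mult_one_mat [of _ n n] left_mult_one_mat [of _ n n]
  have Dc [simp]: "D d \<in> carrier_mat n n" for d unfolding D_def by simp
  have unique: "V * D (\<lambda>i. f (e i)) * mat_adjoint V = U * D (\<lambda>i. f (d i)) * mat_adjoint U"
    if "unitary_diagonalization A V e" for V e
  proof -
    define U' where "U' = mat_adjoint U"
    define V' where "V' = mat_adjoint V"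
    have U: "U \<in> carrier_mat n n" "U' \<in> carrier_mat n n" "U' * U = 1\<^sub>m n" "A = U * D d * U'"
      using assms mat_adjoint_carrier
      unfolding unitary_diagonalization_def n_def [symmetric] D_def U'_def by auto
    have V: "V \<in> carrier_mat n n" "V' \<in> carrier_mat n n" "V' * V = 1\<^sub>m n" "A = V * D e * V'"
      using that mat_adjoint_carrier
      unfolding unitary_diagonalization_def n_def [symmetric] D_def V'_def by auto
    have UU: "U * U' = 1\<^sub>m n" using mat_mult_left_right_inverse U by blast
    have VV: "V * V' = 1\<^sub>m n" using mat_mult_left_right_inverse V by blast
    define W where "W = V' * U"
    have W: "W \<in> carrier_mat n n" unfolding W_def using U V by simp
    have "W * D d = V' * (U * D d * (U' * U))"
      unfolding W_def using U V by (simp add: mat_simps)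
    also have "\<dots> = V' * A * U"
      using U(1,2) V(1,2) by (simp add: U(4) mat_simps)
    also have "\<dots> = (V' * V) * D e * W"
      unfolding W_def using U(1,2) V(1,2) by (simp add: V(4) mat_simps)
    finally have WD: "W * D d = D e * W" using V W by (simp add: mat_simps)
    have "W * D (\<lambda>i. f (d i)) = D (\<lambda>i. f (e i)) * W"
    proof (rule eq_matI)
      fix i j assume "i < dim_row (D (\<lambda>i. f (e i)) * W)" "j < dim_col (D (\<lambda>i. f (e i)) * W)"
      with W have ij: "i < n" "j < n" by (auto simp: D_def mat_diag_def)
      have "(W * D d) $$ (i, j) = (D e * W) $$ (i, j)" using WD by simp
      hence "W $$ (i, j) * of_real (d j) = of_real (e i) * W $$ (i, j)"
        unfolding D_def using W ij by (simp add: mat_diag_mult_left mat_diag_mult_right)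
      hence "W $$ (i, j) = 0 \<or> d j = e i" by auto
      thus "(W * D (\<lambda>i. f (d i))) $$ (i, j) = (D (\<lambda>i. f (e i)) * W) $$ (i, j)"
        unfolding D_def using W ij by (auto simp: mat_diag_mult_left mat_diag_mult_right)
    qed (use W in \<open>auto simp: D_def mat_diag_def\<close>)
    hence eq: "V * (W * D (\<lambda>i. f (d i))) * U' = V * (D (\<lambda>i. f (e i)) * W) * U'" by simp
    have "V * (W * D (\<lambda>i. f (d i))) * U' = (V * V') * U * D (\<lambda>i. f (d i)) * U'"
      unfolding W_def using U(1,2) V(1,2) by (simp add: mat_simps)
    moreover have "V * (D (\<lambda>i. f (e i)) * W) * U' = V * D (\<lambda>i. f (e i)) * V' * (U * U')"
      unfolding W_def using U(1,2) V(1,2) by (simp add: mat_simps)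
    ultimately show ?thesis
      using eq U(1,2) V(1,2) unfolding UU VV U'_def [symmetric] V'_def [symmetric]
      by (simp add: mat_simps)
  qed
  show ?thesis
    unfolding hermitian_fun_def
  proof (rule the_equality)
    show "\<exists>V e. unitary_diagonalization A V e \<and>
        U * mat_diag (dim_row A) (\<lambda>i. complex_of_real (f (d i))) * mat_adjoint U =
        V * mat_diag (dim_row A) (\<lambda>i. complex_of_real (f (e i))) * mat_adjoint V"
      using assms by blast
  qed (elim exE conjE, simp only: unique [unfolded D_def n_def])
qed

definition gibbs_state :: "complex mat \<Rightarrow> real \<Rightarrow> complex mat" where
  "gibbs_state H \<tau> =
     (let E = mat_exp (complex_of_real (- \<tau>) \<cdot>\<^sub>m H) in (1 / mat_trace E) \<cdot>\<^sub>m E)"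

(* Since ln 0 = 0, a zero eigenvalue contributes 0 log 0 = 0. The trace is real for a density matrix. *)
definition von_neumann_entropy :: "complex mat \<Rightarrow> real" where
  "von_neumann_entropy \<rho> = - Re (mat_trace (\<rho> * hermitian_fun ln \<rho>))"

end

theory Submission
  imports Defs
begin

text \<open>
  A bounded Hamiltonian at a fixed temperature cannot move the Gibbs state far from the maximally
  mixed one. Write \<open>H = U diag(d) U\<^sup>*\<close> with \<open>U\<close> unitary. The exponential series, the normalisation
  by the trace and the logarithm all act on the diagonal factor alone, so the entropy of the Gibbs
  state is the Shannon entropy of the Boltzmann weights \<open>p\<^sub>i = exp (- \<tau> d\<^sub>i) / Z\<close>, where
  \<open>Z = \<Sum>\<^sub>j exp (- \<tau> d\<^sub>j)\<close>. Since every eigenvalue satisfies \<open>\<bar>d\<^sub>i\<bar> \<le> K\<close>, both \<open>exp (- \<tau> d\<^sub>i)\<close> and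
  the average \<open>Z / n\<close> lie between \<open>exp (- \<bar>\<tau>\<bar> K)\<close> and \<open>exp (\<bar>\<tau>\<bar> K)\<close>; hence \<open>n p\<^sub>i\<close> is within a factor
  \<open>exp (2 \<bar>\<tau>\<bar> K)\<close> of \<open>1\<close>, and the weighted average \<open>ln n - S = \<Sum>\<^sub>i p\<^sub>i ln (n p\<^sub>i)\<close> is at most
  \<open>2 \<bar>\<tau>\<bar> K\<close> in absolute value, uniformly in \<open>n\<close>.

  Three ingredients carry this argument: the spectral theorem
  (\<open>hermitian_unitary_diagonalization\<close>), the bound of eigenvalues by the spectral norm
  (\<open>eigenvalue_le_spectral_norm\<close>), and the rules by which products, powers, exponentials and traces
  of \<open>U diag(f) U\<^sup>*\<close> reduce to the diagonal \<open>f\<close>.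
\<close>

text \<open>
  The symbols for vector entries and scalar products refer below to vectors whose dimension is a
  value, not a type.
\<close>

unbundle no vec_syntax
unbundle no inner_syntax

section \<open>The conjugate transpose\<close>

lemma mat_adjoint_index:
  "i < dim_col A \<Longrightarrow> j < dim_row A \<Longrightarrow> mat_adjoint A $$ (i, j) = cnj (A $$ (j, i))"
  unfolding mat_adjoint_def by (simp add: mat_of_rows_index)

lemma mat_adjoint_dims [simp]:
  "dim_row (mat_adjoint A) = dim_col A" "dim_col (mat_adjoint A) = dim_row A"
  unfolding mat_adjoint_def by auto

lemma mat_adjoint_adjoint: "mat_adjoint (mat_adjoint A) = (A :: complex mat)"
  by (rule eq_matI) (auto simp: mat_adjoint_index)

lemma mat_adjoint_mult:
  fixes A B :: "complex mat"
  assumes "A \<in> carrier_mat n m" "B \<in> carrier_mat m l"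
  shows "mat_adjoint (A * B) = mat_adjoint B * mat_adjoint A"
  by (rule eq_matI)
    (use assms in \<open>auto simp: mat_adjoint_index scalar_prod_def mult.commute\<close>)

lemma mat_adjoint_four_block_diag:
  fixes B D :: "complex mat"
  assumes "B \<in> carrier_mat n n" "D \<in> carrier_mat m m"
  shows "mat_adjoint (four_block_mat B (0\<^sub>m n m) (0\<^sub>m m n) D)
    = four_block_mat (mat_adjoint B) (0\<^sub>m n m) (0\<^sub>m m n) (mat_adjoint D)"
  by (rule eq_matI) (use assms in \<open>auto simp: mat_adjoint_index\<close>)

lemma mult_four_block_diag:
  fixes A1 A2 D1 D2 :: "complex mat"
  assumes "A1 \<in> carrier_mat n n" "A2 \<in> carrier_mat n n"
    "D1 \<in> carrier_mat m m" "D2 \<in> carrier_mat m m"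
  shows "four_block_mat A1 (0\<^sub>m n m) (0\<^sub>m m n) D1 * four_block_mat A2 (0\<^sub>m n m) (0\<^sub>m m n) D2
    = four_block_mat (A1 * A2) (0\<^sub>m n m) (0\<^sub>m m n) (D1 * D2)"
  using assms by (subst mult_four_block_mat [of _ n n _ m _ m _ _ n _ m]) auto

section \<open>The spectral theorem for Hermitian matrices\<close>

text \<open>
  Every direction is the first column of some unitary matrix: extend \<open>v\<close> to a basis, apply
  Gram-Schmidt, which keeps the first vector, and divide every vector by its norm.
\<close>

lemma unitary_completion:
  fixes v :: "complex vec"
  assumes v: "v \<in> carrier_vec n" "v \<noteq> 0\<^sub>v n"
  obtains W c where "W \<in> carrier_mat n n" "mat_adjoint W * W = 1\<^sub>m n" "col W 0 = c \<cdot>\<^sub>v v"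
proof -
  interpret cof_vec_space n "TYPE(complex)" .
  have n: "n \<noteq> 0" using v by (auto intro: eq_vecI)
  define b where "b = basis_completion v"
  from basis_completion [OF v, folded b_def] have b: "distinct b" "\<not> lin_dep (set b)"
    "set b \<subseteq> carrier_vec n" "hd b = v" "length b = n"
    by auto
  then obtain vs where bv: "b = v # vs" using n by (cases b) auto
  define ws where "ws = gram_schmidt n b"
  from gram_schmidt_result [OF b(3,1,2) refl, folded ws_def] b(5)
  have ws: "set ws \<subseteq> carrier_vec n" "corthogonal ws" "length ws = n" by auto
  have hd: "hd ws = v" unfolding ws_def bv by (rule gram_schmidt_hd [OF v(1)])
  hence ws0: "ws ! 0 = v" using ws n by (cases ws) auto
  have wsi: "ws ! i \<in> carrier_vec n" if "i < n" for i using ws that by auto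
  define r where "r i = vec_norm2 (ws ! i)" for i
  define W where "W = mat n n (\<lambda>(i, j). ws ! j $ i / complex_of_real (r j))"
  have r2: "complex_of_real (r j * r j) = (\<Sum>i<n. cnj (ws ! j $ i) * ws ! j $ i)" if "j < n" for j
  proof -
    have "r j * r j = (\<Sum>i<n. (cmod (ws ! j $ i))\<^sup>2)"
      using wsi [OF that] unfolding r_def vec_norm2_def by (simp add: sum_nonneg)
    thus ?thesis by (simp add: complex_norm_square mult.commute del: of_real_power of_real_mult)
  qed
  have ip: "(\<Sum>i<n. cnj (ws ! j $ i) * ws ! k $ i) = ws ! k \<bullet>c ws ! j" if "j < n" "k < n" for j k
    using wsi [OF that(1)] wsi [OF that(2)] that
    by (simp add: scalar_prod_def lessThan_atLeast0 carrier_vecD mult.commute)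
  have r0: "r j \<noteq> 0" if "j < n" for j
    using r2 [OF that] ip [OF that that] corthogonalD [OF ws(2), of j j] ws(3) that by auto
  show ?thesis
  proof
    show W: "W \<in> carrier_mat n n" unfolding W_def by simp
    show "mat_adjoint W * W = 1\<^sub>m n"
    proof (rule eq_matI)
      fix j k assume "j < dim_row (1\<^sub>m n :: complex mat)" "k < dim_col (1\<^sub>m n :: complex mat)"
      hence jk: "j < n" "k < n" by auto
      have "(mat_adjoint W * W) $$ (j, k)
          = (\<Sum>i<n. cnj (ws ! j $ i) * ws ! k $ i) / complex_of_real (r j * r k)"
        using jk W unfolding W_def
        by (simp add: scalar_prod_def mat_adjoint_index lessThan_atLeast0 sum_divide_distrib)
      also have "\<dots> = (if j = k then 1 else 0)"
      proof (cases "j = k")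
        case True
        thus ?thesis using r2 [OF jk(1)] r0 [OF jk(1)] by (metis div_self mult_eq_0_iff of_real_eq_0_iff)
      next
        case False
        thus ?thesis using ip [OF jk] corthogonalD [OF ws(2), of k j] ws(3) jk by auto
      qed
      finally show "(mat_adjoint W * W) $$ (j, k) = 1\<^sub>m n $$ (j, k)" using jk by simp
    qed (use W in auto)
    show "col W 0 = (1 / complex_of_real (r 0)) \<cdot>\<^sub>v v"
      using v n by (intro eq_vecI) (auto simp: W_def ws0)
  qed
qed

lemma complex_mat_has_eigenvector:
  fixes A :: "complex mat"
  assumes A: "A \<in> carrier_mat n n" and n: "n \<noteq> 0"
  obtains e v where "eigenvector A v e"
proof -
  from char_poly_factorized [OF A] obtain es
    where es: "char_poly A = (\<Prod>a\<leftarrow>es. [:- a, 1:])" "length es = n" by blast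
  then obtain e es' where "es = e # es'" using n by (cases es) auto
  hence "eigenvalue A e" using es unfolding eigenvalue_root_char_poly [OF A] by simp
  thus ?thesis using find_eigenvector [OF A] that by blast
qed

text \<open>
  Deflation. An eigenvector becomes the first column of a unitary \<open>W\<close>, so the first column of
  \<open>W\<^sup>* A W\<close> is a multiple of the first unit vector. As \<open>W\<^sup>* A W\<close> is again Hermitian, the same holds
  for its first row, and the eigenvalue, being a diagonal entry, is real. What remains is a
  Hermitian block of size one less, which the induction hypothesis diagonalises.
\<close>

theorem hermitian_unitary_diagonalization:
  assumes "A \<in> carrier_mat n n" "mat_adjoint A = A"
  shows "\<exists>U d. unitary_diagonalization A U d"
  using assms
proof (induction n arbitrary: A)
  case 0
  show ?case
    unfolding unitary_diagonalization_def
    by (rule exI [of _ "1\<^sub>m 0"], rule exI [of _ "\<lambda>_. 0"])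
      (use 0 in \<open>auto intro!: eq_matI\<close>)
next
  case (Suc m)
  let ?n = "Suc m"
  note A = Suc.prems(1)
  obtain e v where "eigenvector A v e" using complex_mat_has_eigenvector [OF A] by blast
  hence v: "v \<in> carrier_vec ?n" "v \<noteq> 0\<^sub>v ?n" and ev: "A *\<^sub>v v = e \<cdot>\<^sub>v v"
    using A unfolding eigenvector_def by auto
  obtain W c where W: "W \<in> carrier_mat ?n ?n" and W1: "mat_adjoint W * W = 1\<^sub>m ?n"
    and Wv: "col W 0 = c \<cdot>\<^sub>v v"
    using unitary_completion [OF v] .
  define W' where "W' = mat_adjoint W"
  have W': "W' \<in> carrier_mat ?n ?n" unfolding W'_def using W by (rule mat_adjoint_carrier)
  have W'W: "W' * W = 1\<^sub>m ?n" using W1 unfolding W'_def .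
  have WW': "W * W' = 1\<^sub>m ?n" using mat_mult_left_right_inverse [OF W' W W'W] .
  note mat_simps = assoc_mult_mat [of _ ?n ?n _ ?n _ ?n] mult_carrier_mat [of _ ?n ?n _ ?n]
    right_mult_one_mat [of _ ?n ?n] left_mult_one_mat [of _ ?n ?n]
  define B where "B = W' * (A * W)"
  have B: "B \<in> carrier_mat ?n ?n" unfolding B_def using A W W' by simp
  have "W * B * W' = (W * W') * A * (W * W')"
    unfolding B_def using A W W' by (simp add: mat_simps)
  hence AB: "A = W * B * W'" using A unfolding WW' by simp
  have "mat_adjoint B = (mat_adjoint W * mat_adjoint A) * mat_adjoint W'"
    unfolding B_def using A W W' by (simp add: mat_adjoint_mult [of _ ?n ?n _ ?n] mat_simps)
  also have "\<dots> = B"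
    unfolding B_def Suc.prems(2) W'_def mat_adjoint_adjoint using A W W'
    by (simp add: mat_simps W'_def)
  finally have Bh: "mat_adjoint B = B" .
  have Bcol: "B $$ (i, 0) = (if i = 0 then e else 0)" if "i < ?n" for i
  proof -
    have "col (A * W) 0 = A *\<^sub>v col W 0"
      by (rule eq_vecI) (use A W in auto)
    also have "\<dots> = e \<cdot>\<^sub>v col W 0"
      unfolding Wv using A v ev by (simp add: mult_mat_vec [of _ ?n ?n] smult_smult_assoc mult.commute)
    finally have col: "col (A * W) 0 = e \<cdot>\<^sub>v col W 0" .
    have "B $$ (i, 0) = row W' i \<bullet> col (A * W) 0"
      unfolding B_def using A W W' that by simp
    also have "\<dots> = e * (row W' i \<bullet> col W 0)"
      unfolding col using W W' that by simp
    also have "row W' i \<bullet> col W 0 = (W' * W) $$ (i, 0)" using W W' that by simp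
    finally show ?thesis unfolding W'W using that by simp
  qed
  have Bcnj: "B $$ (i, j) = cnj (B $$ (j, i))" if "i < ?n" "j < ?n" for i j
    using mat_adjoint_index [of i B j] B that unfolding Bh by simp
  have Brow: "B $$ (0, j) = (if j = 0 then e else 0)" if "j < ?n" for j
    using Bcnj [of 0 j] Bcol [of j] Bcol [of 0] that by (cases "j = 0") auto
  have e: "complex_of_real (Re e) = e" using Bcnj [of 0 0] Bcol [of 0] by (simp add: complex_eq_iff)
  \<comment> \<open>The block left over once the first row and column of \<open>B\<close> are split off.\<close>
  define A' where "A' = mat m m (\<lambda>(i, j). B $$ (Suc i, Suc j))"
  have A': "A' \<in> carrier_mat m m" unfolding A'_def by simp
  have "mat_adjoint A' = A'"
    by (rule eq_matI) (auto simp: A'_def mat_adjoint_index intro: Bcnj [symmetric])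
  then obtain V d where "unitary_diagonalization A' V d" using Suc.IH [OF A'] by blast
  hence V: "V \<in> carrier_mat m m" "mat_adjoint V * V = 1\<^sub>m m"
    and A'V: "A' = V * mat_diag m (\<lambda>i. complex_of_real (d i)) * mat_adjoint V"
    using A' unfolding unitary_diagonalization_def by auto
  have V': "mat_adjoint V \<in> carrier_mat m m" using V(1) by (rule mat_adjoint_carrier)
  let ?F = "\<lambda>E G. four_block_mat E (0\<^sub>m 1 m) (0\<^sub>m m 1) G :: complex mat"
  define E where "E = mat 1 1 (\<lambda>_. e)"
  have E: "E \<in> carrier_mat 1 1" unfolding E_def by simp
  have BF: "B = ?F E A'"
    by (rule eq_matI) (use B Bcol Brow in \<open>auto simp: A'_def E_def\<close>)
  define X where "X = ?F (1\<^sub>m 1) V"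
  have one: "mat_adjoint (1\<^sub>m 1 :: complex mat) = 1\<^sub>m 1"
    by (rule eq_matI) (auto simp: mat_adjoint_index)
  have X': "mat_adjoint X = ?F (1\<^sub>m 1) (mat_adjoint V)"
    unfolding X_def using mat_adjoint_four_block_diag [of "1\<^sub>m 1" 1 V m] V one by simp
  have Xc: "X \<in> carrier_mat ?n ?n" "mat_adjoint X \<in> carrier_mat ?n ?n"
    using V(1) unfolding X_def by (auto intro!: carrier_matI)
  have X1: "mat_adjoint X * X = 1\<^sub>m ?n"
    unfolding X' unfolding X_def using mult_four_block_diag [of "1\<^sub>m 1" 1 "1\<^sub>m 1" "mat_adjoint V" m V] V V'
    by simp
  define d' where "d' = case_nat (Re e) d"
  let ?D = "mat_diag ?n (\<lambda>i. complex_of_real (d' i))"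
  have DF: "?D = ?F E (mat_diag m (\<lambda>i. complex_of_real (d i)))"
    by (rule eq_matI) (auto simp: mat_diag_def d'_def E_def e split: nat.split)
  have "X * ?D * mat_adjoint X = ?F E A'"
    unfolding X' DF unfolding X_def A'V using V(1) V' E
    by (simp add: mult_four_block_diag [where n = "Suc 0" and m = m] mult_carrier_mat [of _ m m _ m])
  hence BX: "B = X * ?D * mat_adjoint X" using BF by simp
  define U where "U = W * X"
  have U: "U \<in> carrier_mat ?n ?n" unfolding U_def using W Xc by simp
  have U': "mat_adjoint U = mat_adjoint X * W'"
    unfolding U_def W'_def using W Xc by (intro mat_adjoint_mult)
  have "mat_adjoint U * U = mat_adjoint X * (W' * W) * X"
    unfolding U' unfolding U_def using W W' Xc by (simp add: mat_simps)
  hence U1: "mat_adjoint U * U = 1\<^sub>m ?n" unfolding W'W using Xc X1 by simp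
  have "A = U * ?D * mat_adjoint U"
    unfolding U' AB BX unfolding U_def using W W' Xc by (simp add: mat_simps)
  thus ?case using A U U1 unfolding unitary_diagonalization_def by auto
qed

section \<open>Calculus of unitarily diagonalised matrices\<close>

lemma unitary_conj_diag_index:
  fixes U :: "complex mat"
  assumes "U \<in> carrier_mat n n" "i < n" "j < n"
  shows "(U * mat_diag n f * mat_adjoint U) $$ (i, j) = (\<Sum>k<n. U $$ (i, k) * f k * cnj (U $$ (j, k)))"
  using assms
  by (simp add: mat_diag_mult_right [of _ n] scalar_prod_def mat_adjoint_index lessThan_atLeast0)

lemma unitary_conj_diag_carrier:
  fixes U :: "complex mat"
  assumes "U \<in> carrier_mat n n"
  shows "U * mat_diag n f * mat_adjoint U \<in> carrier_mat n n"
  by (intro mult_carrier_mat [of _ n n] mat_diag_dim assms mat_adjoint_carrier)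

lemma unitary_columns:
  assumes "U \<in> carrier_mat n n" "mat_adjoint U * U = 1\<^sub>m n" "k < n"
  shows "(\<Sum>i<n. (cmod (U $$ (i, k)))\<^sup>2) = 1"
proof -
  have "complex_of_real (\<Sum>i<n. (cmod (U $$ (i, k)))\<^sup>2) = (\<Sum>i<n. cnj (U $$ (i, k)) * U $$ (i, k))"
    by (simp add: complex_norm_square mult.commute del: of_real_power)
  also have "\<dots> = (mat_adjoint U * U) $$ (k, k)"
    using assms(1,3) by (simp add: scalar_prod_def mat_adjoint_index lessThan_atLeast0)
  also have "\<dots> = 1" unfolding assms(2) using assms(3) by simp
  finally show ?thesis by (simp only: of_real_eq_1_iff)
qed

text \<open>
  In the double sum of \<open>f k * \<bar>U\<^sub>i\<^sub>k\<bar>\<^sup>2\<close> the index \<open>i\<close> is summed first, and the columns of \<open>U\<close> have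
  norm one.
\<close>

lemma mat_trace_unitary_conj_diag:
  assumes U: "U \<in> carrier_mat n n" "mat_adjoint U * U = 1\<^sub>m n"
  shows "mat_trace (U * mat_diag n f * mat_adjoint U) = (\<Sum>k<n. f k)"
proof -
  have "mat_trace (U * mat_diag n f * mat_adjoint U)
      = (\<Sum>i<n. \<Sum>k<n. f k * complex_of_real ((cmod (U $$ (i, k)))\<^sup>2))"
    unfolding mat_trace_def using unitary_conj_diag_carrier [OF U(1), of f]
    by (intro sum.cong)
      (auto simp: unitary_conj_diag_index [OF U(1)] complex_norm_square mult_ac simp del: of_real_power)
  also have "\<dots> = (\<Sum>k<n. f k * complex_of_real (\<Sum>i<n. (cmod (U $$ (i, k)))\<^sup>2))"
    by (subst sum.swap) (simp add: sum_distrib_left)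
  also have "\<dots> = (\<Sum>k<n. f k)" using unitary_columns [OF U] by simp
  finally show ?thesis .
qed

lemma unitary_conj_diag_mult:
  fixes U :: "complex mat"
  assumes U: "U \<in> carrier_mat n n" "mat_adjoint U * U = 1\<^sub>m n"
  shows "(U * mat_diag n f * mat_adjoint U) * (U * mat_diag n g * mat_adjoint U)
    = U * mat_diag n (\<lambda>i. f i * g i) * mat_adjoint U"
proof -
  define U' where "U' = mat_adjoint U"
  have U': "U' \<in> carrier_mat n n" unfolding U'_def using U(1) by (rule mat_adjoint_carrier)
  note mat_simps = assoc_mult_mat [of _ n n _ n _ n] mult_carrier_mat [of _ n n _ n]
    right_mult_one_mat [of _ n n] left_mult_one_mat [of _ n n]
  have "(U * mat_diag n f * U') * (U * mat_diag n g * U')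
      = U * (mat_diag n f * ((U' * U) * (mat_diag n g * U')))"
    using U(1) U' by (simp add: mat_simps)
  also have "\<dots> = U * ((mat_diag n f * mat_diag n g) * U')"
    unfolding U(2) [folded U'_def] using U(1) U' by (simp add: mat_simps del: mat_diag_diag)
  finally show ?thesis unfolding U'_def [symmetric] using U(1) U' by (simp add: mat_simps)
qed

lemma unitary_conj_diag_pow:
  fixes U :: "complex mat"
  assumes U: "U \<in> carrier_mat n n" "mat_adjoint U * U = 1\<^sub>m n"
  shows "(U * mat_diag n f * mat_adjoint U) ^\<^sub>m k = U * mat_diag n (\<lambda>i. f i ^ k) * mat_adjoint U"
proof (induction k)
  case 0
  have "U * mat_adjoint U = 1\<^sub>m n"
    using mat_mult_left_right_inverse [OF mat_adjoint_carrier [OF U(1)] U] .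
  thus ?case using U(1) by simp
next
  case (Suc k)
  show ?case
    by (simp add: Suc unitary_conj_diag_mult [OF U] mult.commute)
qed

lemma smult_unitary_conj_diag:
  fixes U :: "complex mat"
  assumes U: "U \<in> carrier_mat n n"
  shows "c \<cdot>\<^sub>m (U * mat_diag n f * mat_adjoint U) = U * mat_diag n (\<lambda>i. c * f i) * mat_adjoint U"
proof (rule eq_matI)
  fix i j
  assume "i < dim_row (U * mat_diag n (\<lambda>i. c * f i) * mat_adjoint U)"
    "j < dim_col (U * mat_diag n (\<lambda>i. c * f i) * mat_adjoint U)"
  hence ij: "i < n" "j < n" using U by auto
  have "(c \<cdot>\<^sub>m (U * mat_diag n f * mat_adjoint U)) $$ (i, j)
      = c * (U * mat_diag n f * mat_adjoint U) $$ (i, j)"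
    using ij unitary_conj_diag_carrier [OF U, of f] by (intro index_smult_mat) auto
  thus "(c \<cdot>\<^sub>m (U * mat_diag n f * mat_adjoint U)) $$ (i, j)
      = (U * mat_diag n (\<lambda>i. c * f i) * mat_adjoint U) $$ (i, j)"
    by (simp only: unitary_conj_diag_index [OF U ij]) (simp add: sum_distrib_left mult_ac)
qed (use U in auto)

text \<open>
  Each entry of \<open>U diag(f)\<^sup>k U\<^sup>*\<close> is a fixed linear combination of the \<open>k\<close>-th powers of the \<open>f l\<close>, so
  the entrywise series is a finite combination of scalar exponential series.
\<close>

lemma mat_exp_unitary_conj_diag:
  assumes U: "U \<in> carrier_mat n n" "mat_adjoint U * U = 1\<^sub>m n"
  shows "mat_exp (U * mat_diag n f * mat_adjoint U) = U * mat_diag n (\<lambda>i. exp (f i)) * mat_adjoint U"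
proof -
  let ?M = "\<lambda>f. U * mat_diag n f * mat_adjoint U"
  have "(\<Sum>k. (?M f ^\<^sub>m k) $$ (i, j) / fact k) = ?M (\<lambda>i. exp (f i)) $$ (i, j)" if ij: "i < n" "j < n" for i j
  proof (rule sums_unique [symmetric])
    have "(\<lambda>k. \<Sum>l<n. U $$ (i, l) * (f l ^ k /\<^sub>R fact k) * cnj (U $$ (j, l)))
        sums (\<Sum>l<n. U $$ (i, l) * exp (f l) * cnj (U $$ (j, l)))"
      by (intro sums_sum sums_mult sums_mult2 exp_converges)
    moreover have "(?M f ^\<^sub>m k) $$ (i, j) / fact k
        = (\<Sum>l<n. U $$ (i, l) * (f l ^ k /\<^sub>R fact k) * cnj (U $$ (j, l)))" for k
      by (simp add: unitary_conj_diag_pow [OF U] unitary_conj_diag_index [OF U(1) ij]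
          sum_divide_distrib scaleR_conv_of_real field_simps)
    ultimately show "(\<lambda>k. (?M f ^\<^sub>m k) $$ (i, j) / fact k) sums ?M (\<lambda>i. exp (f i)) $$ (i, j)"
      by (simp add: unitary_conj_diag_index [OF U(1) ij])
  qed
  thus ?thesis
    unfolding mat_exp_def using U(1) by (intro eq_matI) auto
qed

section \<open>Gibbs states and their entropy\<close>

definition gibbs_weight :: "nat \<Rightarrow> (nat \<Rightarrow> real) \<Rightarrow> real \<Rightarrow> nat \<Rightarrow> real" where
  "gibbs_weight n d \<tau> i = exp (- \<tau> * d i) / (\<Sum>j<n. exp (- \<tau> * d j))"

lemma gibbs_state_unitary_diagonalization:
  assumes H: "H \<in> carrier_mat n n" and D: "unitary_diagonalization H U d"
  shows "unitary_diagonalization (gibbs_state H \<tau>) U (gibbs_weight n d \<tau>)"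
    and "gibbs_state H \<tau> \<in> carrier_mat n n"
proof -
  have U: "U \<in> carrier_mat n n" "mat_adjoint U * U = 1\<^sub>m n"
    and HU: "H = U * mat_diag n (\<lambda>i. complex_of_real (d i)) * mat_adjoint U"
    using H D unfolding unitary_diagonalization_def by auto
  have E: "mat_exp (complex_of_real (- \<tau>) \<cdot>\<^sub>m H)
      = U * mat_diag n (\<lambda>i. complex_of_real (exp (- \<tau> * d i))) * mat_adjoint U"
    unfolding HU smult_unitary_conj_diag [OF U(1)] mat_exp_unitary_conj_diag [OF U]
    by (simp flip: exp_of_real)
  have G: "gibbs_state H \<tau> = U * mat_diag n (\<lambda>i. complex_of_real (gibbs_weight n d \<tau> i)) * mat_adjoint U"
    unfolding gibbs_state_def Let_def E mat_trace_unitary_conj_diag [OF U]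
      smult_unitary_conj_diag [OF U(1)] gibbs_weight_def by simp
  show carrier: "gibbs_state H \<tau> \<in> carrier_mat n n"
    unfolding G using U(1) by (rule unitary_conj_diag_carrier)
  show "unitary_diagonalization (gibbs_state H \<tau>) U (gibbs_weight n d \<tau>)"
    unfolding unitary_diagonalization_def using carrier U G by auto
qed

text \<open>
  The functional calculus gives the same result in every diagonalisation, so \<open>ln\<close> may be evaluated
  in the given one, where \<open>\<rho>\<close> and \<open>ln \<rho>\<close> are diagonal together.
\<close>

lemma von_neumann_entropy_eq_shannon:
  assumes R: "\<rho> \<in> carrier_mat n n" and D: "unitary_diagonalization \<rho> U p"
  shows "von_neumann_entropy \<rho> = - (\<Sum>i<n. p i * ln (p i))"
proof -
  have U: "U \<in> carrier_mat n n" "mat_adjoint U * U = 1\<^sub>m n"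
    and RU: "\<rho> = U * mat_diag n (\<lambda>i. complex_of_real (p i)) * mat_adjoint U"
    using R D unfolding unitary_diagonalization_def by auto
  have L: "hermitian_fun ln \<rho> = U * mat_diag n (\<lambda>i. complex_of_real (ln (p i))) * mat_adjoint U"
    using hermitian_fun_eq [OF D] R by simp
  have "mat_trace (\<rho> * hermitian_fun ln \<rho>) = (\<Sum>i<n. complex_of_real (p i) * complex_of_real (ln (p i)))"
    unfolding L by (subst RU) (simp only: unitary_conj_diag_mult [OF U] mat_trace_unitary_conj_diag [OF U])
  thus ?thesis unfolding von_neumann_entropy_def by simp
qed

section \<open>Eigenvalues and the spectral norm\<close>

lemma vec_norm2_smult: "vec_norm2 (c \<cdot>\<^sub>v v) = cmod c * vec_norm2 v"
  unfolding vec_norm2_def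
  by (simp add: norm_mult power_mult_distrib flip: sum_distrib_left) (simp add: real_sqrt_mult)

lemma cmod_le_vec_norm2:
  assumes "i < dim_vec v"
  shows "cmod (v $ i) \<le> vec_norm2 v"
proof -
  have "(cmod (v $ i))\<^sup>2 \<le> (\<Sum>i<dim_vec v. (cmod (v $ i))\<^sup>2)"
    using assms by (intro member_le_sum) auto
  thus ?thesis unfolding vec_norm2_def by (simp add: real_le_rsqrt)
qed

text \<open>
  A supremum of reals bounds its members only if the set is bounded above. A crude bound suffices:
  the entries of a vector in the unit ball have modulus at most one.
\<close>

lemma vec_norm2_mult_le_spectral_norm:
  assumes v: "v \<in> carrier_vec (dim_col A)" "vec_norm2 v \<le> 1"
  shows "vec_norm2 (A *\<^sub>v v) \<le> spectral_norm A"
  unfolding spectral_norm_def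
proof (rule cSUP_upper)
  show "bdd_above ((\<lambda>v. vec_norm2 (A *\<^sub>v v)) ` {v \<in> carrier_vec (dim_col A). vec_norm2 v \<le> 1})"
  proof (rule bdd_aboveI2)
    fix w assume w: "w \<in> {v \<in> carrier_vec (dim_col A). vec_norm2 v \<le> 1}"
    have entry: "cmod (w $ j) \<le> 1" if "j < dim_col A" for j
      using cmod_le_vec_norm2 [of j w] w that by auto
    have "cmod ((A *\<^sub>v w) $ i) \<le> (\<Sum>j<dim_col A. cmod (A $$ (i, j)))" if i: "i < dim_row A" for i
    proof -
      have "(A *\<^sub>v w) $ i = (\<Sum>j<dim_col A. A $$ (i, j) * w $ j)"
        using w i by (auto simp: scalar_prod_def lessThan_atLeast0)
      also have "cmod \<dots> \<le> (\<Sum>j<dim_col A. cmod (A $$ (i, j)))"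
        by (intro sum_norm_le) (use entry in \<open>auto simp: norm_mult intro: mult_left_le\<close>)
      finally show ?thesis .
    qed
    thus "vec_norm2 (A *\<^sub>v w) \<le> sqrt (\<Sum>i<dim_row A. (\<Sum>j<dim_col A. cmod (A $$ (i, j)))\<^sup>2)"
      unfolding vec_norm2_def by (intro real_sqrt_le_mono) (auto intro!: sum_mono power_mono)
  qed
qed (use v in auto)

text \<open>The \<open>i\<close>-th column of \<open>U\<close> is a unit vector which \<open>A\<close> multiplies by \<open>d i\<close>.\<close>

lemma eigenvalue_le_spectral_norm:
  assumes A: "A \<in> carrier_mat n n" and D: "unitary_diagonalization A U d" and i: "i < n"
  shows "\<bar>d i\<bar> \<le> spectral_norm A"
proof -
  let ?D = "mat_diag n (\<lambda>i. complex_of_real (d i))"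
  have U: "U \<in> carrier_mat n n" "mat_adjoint U * U = 1\<^sub>m n" and AU: "A = U * ?D * mat_adjoint U"
    using A D unfolding unitary_diagonalization_def by auto
  have U': "mat_adjoint U \<in> carrier_mat n n" using U(1) by (rule mat_adjoint_carrier)
  have "A * U = U * ?D * (mat_adjoint U * U)"
    unfolding AU using U(1) U' 
    by (simp add: assoc_mult_mat [of _ n n _ n _ n] mult_carrier_mat [of _ n n _ n])
  hence AU2: "A * U = U * ?D"
    unfolding U(2) using U(1)
    by (simp add: mult_carrier_mat [of _ n n _ n] right_mult_one_mat [of _ n n])
  have "A *\<^sub>v col U i = col (A * U) i"
    by (rule eq_vecI) (use A U(1) i in auto)
  also have "\<dots> = complex_of_real (d i) \<cdot>\<^sub>v col U i"
    unfolding AU2 using U(1) i by (intro eq_vecI) (auto simp: mat_diag_mult_right [of _ n])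
  finally have ev: "A *\<^sub>v col U i = complex_of_real (d i) \<cdot>\<^sub>v col U i" .
  have unit: "vec_norm2 (col U i) = 1"
    using unitary_columns [OF U i] U(1) i by (simp add: vec_norm2_def)
  have "vec_norm2 (A *\<^sub>v col U i) \<le> spectral_norm A"
    by (rule vec_norm2_mult_le_spectral_norm) (use A U(1) unit in auto)
  thus ?thesis unfolding ev vec_norm2_smult unit by simp
qed

section \<open>Gibbs states of bounded Hamiltonians are almost uniform\<close>

lemma gibbs_weight_pos: "n \<ge> 1 \<Longrightarrow> 0 < gibbs_weight n d \<tau> i"
  unfolding gibbs_weight_def by (intro divide_pos_pos sum_pos) (auto simp: lessThan_empty_iff)

lemma sum_gibbs_weight:
  assumes "n \<ge> 1"
  shows "(\<Sum>i<n. gibbs_weight n d \<tau> i) = 1"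
proof -
  have "0 < (\<Sum>j<n. exp (- \<tau> * d j))"
    by (rule sum_pos) (use assms in \<open>auto simp: lessThan_empty_iff\<close>)
  thus ?thesis unfolding gibbs_weight_def by (simp flip: sum_divide_distrib)
qed

text \<open>
  One factor \<open>exp (\<bar>\<tau>\<bar> K)\<close> comes from the numerator \<open>exp (- \<tau> * d i)\<close>, the other from the partition
  function, which differs from \<open>n\<close> by at most that factor.
\<close>

lemma gibbs_weight_almost_uniform:
  assumes n: "n \<ge> 1" and d: "\<And>i. i < n \<Longrightarrow> \<bar>d i\<bar> \<le> K" and i: "i < n"
  shows "\<bar>ln (real n) + ln (gibbs_weight n d \<tau> i)\<bar> \<le> 2 * \<bar>\<tau>\<bar> * K"
proof -
  define c where "c = \<bar>\<tau>\<bar> * K"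
  define Z where "Z = (\<Sum>j<n. exp (- \<tau> * d j))"
  have td: "\<bar>\<tau> * d j\<bar> \<le> c" if "j < n" for j
    unfolding c_def abs_mult using d [OF that] by (simp add: mult_left_mono)
  have "real n * exp (- c) \<le> Z"
    unfolding Z_def using td by (intro order.trans [OF _ sum_bounded_below [where K = "exp (- c)"]]) (auto simp: abs_le_iff)
  moreover have "Z \<le> real n * exp c"
    unfolding Z_def using td by (intro order.trans [OF sum_bounded_above [where K = "exp c"]]) (auto simp: abs_le_iff)
  moreover have "0 < real n * exp (- c)" using n by simp
  ultimately have Z: "0 < Z" "ln (real n * exp (- c)) \<le> ln Z" "ln Z \<le> ln (real n * exp c)"
    by auto
  have "ln (gibbs_weight n d \<tau> i) = - (\<tau> * d i) - ln Z"
    unfolding gibbs_weight_def Z_def [symmetric] using Z(1) by (simp add: ln_div)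
  thus ?thesis using Z(2,3) td [OF i] n unfolding c_def by (simp add: ln_mult abs_le_iff)
qed

text \<open>
  Because the weights sum to one, \<open>ln n - S\<close> is the mean of \<open>ln (n p\<^sub>i)\<close> under the weights \<open>p\<^sub>i\<close>
  themselves, so a uniform bound on these logarithms bounds the difference.
\<close>

lemma gibbs_entropy_bound:
  assumes n: "n \<ge> 1" and H: "H \<in> carrier_mat n n" "mat_adjoint H = H" and K: "spectral_norm H \<le> K"
  shows "\<bar>ln (real n) - von_neumann_entropy (gibbs_state H \<tau>)\<bar> \<le> 2 * \<bar>\<tau>\<bar> * K"
proof -
  obtain U d where D: "unitary_diagonalization H U d"
    using hermitian_unitary_diagonalization [OF H] by blast
  define p where "p = gibbs_weight n d \<tau>"
  have p: "0 \<le> p i" "(\<Sum>i<n. p i) = 1" for i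
    unfolding p_def using gibbs_weight_pos [OF n] sum_gibbs_weight [OF n] by (auto intro: less_imp_le)
  have d: "\<bar>d i\<bar> \<le> K" if "i < n" for i
    using eigenvalue_le_spectral_norm [OF H(1) D that] K by simp
  have almost_uniform: "\<bar>ln (real n) + ln (p i)\<bar> \<le> 2 * \<bar>\<tau>\<bar> * K" if "i < n" for i
    unfolding p_def using n d that by (rule gibbs_weight_almost_uniform)
  have "von_neumann_entropy (gibbs_state H \<tau>) = - (\<Sum>i<n. p i * ln (p i))"
    using von_neumann_entropy_eq_shannon gibbs_state_unitary_diagonalization [OF H(1) D]
    unfolding p_def by blast
  hence "ln (real n) - von_neumann_entropy (gibbs_state H \<tau>)
      = (\<Sum>i<n. p i) * ln (real n) + (\<Sum>i<n. p i * ln (p i))"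
    using p(2) by simp
  also have "\<dots> = (\<Sum>i<n. p i * (ln (real n) + ln (p i)))"
    by (simp add: sum_distrib_right distrib_left sum.distrib)
  also have "\<bar>\<dots>\<bar> \<le> (\<Sum>i<n. p i * (2 * \<bar>\<tau>\<bar> * K))"
    by (rule order.trans [OF sum_abs])
      (use almost_uniform p(1) in \<open>auto simp: abs_mult intro!: sum_mono mult_left_mono\<close>)
  also have "\<dots> = 2 * \<bar>\<tau>\<bar> * K" using p(2) by (simp flip: sum_distrib_right)
  finally show ?thesis .
qed

text \<open>
  The bound \<open>2 \<bar>\<tau>\<bar> K\<close> is independent of \<open>n\<close>; adding one makes it a strictly positive constant even
  for \<open>\<tau> = 0\<close> or \<open>K = 0\<close>.
\<close>

theorem theorem5:
  fixes H :: "nat \<Rightarrow> complex mat" and K \<tau> :: real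
  assumes "\<And>n. n \<ge> 1 \<Longrightarrow> H n \<in> carrier_mat n n"
    and "\<And>n. n \<ge> 1 \<Longrightarrow> psd_mat (H n)"
    and "\<And>n. n \<ge> 1 \<Longrightarrow> spectral_norm (H n) \<le> K"
  shows "(\<lambda>n. ln (real n) - von_neumann_entropy (gibbs_state (H n) \<tau>)) \<in> O(\<lambda>_. 1)"
proof (rule landau_o.bigI)
  show "\<forall>\<^sub>F n in sequentially.
      norm (ln (real n) - von_neumann_entropy (gibbs_state (H n) \<tau>)) \<le> (2 * \<bar>\<tau>\<bar> * \<bar>K\<bar> + 1) * norm (1 :: real)"
    using eventually_ge_at_top [of 1]
  proof eventually_elim
    case (elim n)
    have "mat_adjoint (H n) = H n"
      using assms(2) [OF elim] unfolding psd_mat_def hermitian_mat_def by blast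
    moreover have "spectral_norm (H n) \<le> \<bar>K\<bar>" using assms(3) [OF elim] by simp
    ultimately show ?case
      using gibbs_entropy_bound [OF elim assms(1) [OF elim], of "\<bar>K\<bar>" \<tau>] by simp
  qed
qed (simp add: add_nonneg_pos)

end
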